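(* Let $q\ge1$, let $A=(a_1,\ldots,a_q)$, $B=(b_1,\ldots,b_q)$ be real vectors with $B\prec^W A$, and let $0<\sigma\le1$. Then for all integers $m,n\ge0$ the Padé approximant $[m/n]$ at $z=0$ to the function $z\mapsto{}_{q+1}F_q(\sigma,A;B;-z)$ is normal.
   Context: $B\prec^W A$ means: $0<a_1\le\cdots\le a_q$, $0<b_1\le\cdots\le b_q$, and $\sum_{i=1}^{k}a_i\le\sum_{i=1}^{k}b_i$ for $k=1,\ldots,q$. The generalized hypergeometric function is ${}_{q+1}F_q(\sigma,A;B;z)=\sum_{n=0}^{\infty}\frac{(\sigma)_n(a_1)_n\cdots(a_q)_n}{(b_1)_n\cdots(b_q)_n\,n!}z^n$ for $|z|<1$, extended by analytic continuation to $\mathbb{C}\setminus[1,\infty)$; $(a)_0=1$, $(a)_n=a(a+1)\cdots(a+n-1)$. The Padé approximant $[m/n]$ at $z=0$ to $f$ is the rational function $P/Q$ determined by polynomials $P$, $Q\not\equiv0$ with $\deg P\le m$, $\deg Q\le n$ and $f(z)Q(z)-P(z)=O(z^{m+n+1})$ as $z\to0$. The Padé table is the doubly indexed array of all $[m/n]$, $m,n\ge0$. A Padé approximant is called normal if it occupies precisely one entry in the Padé table.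
   Formalization: The case σ=1 with A=B is excluded: there the function is 1/(1+z), so [0/1]=[0/2]=1/(1+z) is not normal and the claim as stated fails. *)

theory Defs
  imports "HOL-Complex_Analysis.Complex_Analysis" "HOL-Computational_Algebra.Fraction_Field"
    "HOL-Library.Landau_Symbols"
begin

(* Reflexive: B = A is allowed.  In that case the hypergeometric function below reduces to
   (1 - z) powr (- sigma), which for sigma = 1 is rational, with [0/1] = [0/2]; so sigma = 1, A = B
   has to be excluded wherever normality of its Pade table is claimed. *)
definition weak_supermaj :: "real list \<Rightarrow> real list \<Rightarrow> bool"  (infix "\<prec>\<^sup>W" 50) where
  "B \<prec>\<^sup>W A \<longleftrightarrow>
     length A = length B \<and>
     (\<forall>a\<in>set A. 0 < a) \<and> sorted A \<and>
     (\<forall>b\<in>set B. 0 < b) \<and> sorted B \<and>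
     (\<forall>k\<in>{1..length A}. sum_list (take k A) \<le> sum_list (take k B))"

definition hypergeom_series :: "real \<Rightarrow> real list \<Rightarrow> real list \<Rightarrow> complex \<Rightarrow> complex" where
  "hypergeom_series \<sigma> A B z =
     eval_fps (fps_hypergeo (map complex_of_real (\<sigma> # A)) (map complex_of_real B) 1) z"

(* Outside the unit disc this is the value of the analytic continuation to the plane slit
   along [1, infinity); that continuation is unique because the slit plane is connected.
   On the slit itself the value is unspecified. *)
definition hypergeom_F :: "real \<Rightarrow> real list \<Rightarrow> real list \<Rightarrow> complex \<Rightarrow> complex" where
  "hypergeom_F \<sigma> A B z =
     (if norm z < 1 then hypergeom_series \<sigma> A B z
      else (THE w. \<exists>F. F holomorphic_on (- (complex_of_real ` {1..})) \<and>
                       (\<forall>u. norm u < 1 \<longrightarrow> F u = hypergeom_series \<sigma> A B u) \<and>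
                       z \<notin> complex_of_real ` {1..} \<and> F z = w))"

definition is_pade :: "(complex \<Rightarrow> complex) \<Rightarrow> nat \<Rightarrow> nat \<Rightarrow> complex poly fract \<Rightarrow> bool" where
  "is_pade f m n R \<longleftrightarrow>
     (\<exists>P Q. Q \<noteq> 0 \<and> degree P \<le> m \<and> degree Q \<le> n \<and>
            (\<lambda>z. f z * poly Q z - poly P z) \<in> O[at 0](\<lambda>z. z ^ (m + n + 1)) \<and>
            R = Fract P Q)"

(* For f analytic at 0 such an R exists and is unique. *)
definition pade :: "(complex \<Rightarrow> complex) \<Rightarrow> nat \<Rightarrow> nat \<Rightarrow> complex poly fract" where
  "pade f m n = (THE R. is_pade f m n R)"

definition pade_normal :: "(complex \<Rightarrow> complex) \<Rightarrow> complex poly fract \<Rightarrow> bool" where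
  "pade_normal f R \<longleftrightarrow> (\<exists>!p::nat \<times> nat. pade f (fst p) (snd p) = R)"

end

theory Submission
  imports Defs "HOL-Real_Asymp.Real_Asymp"
begin

unbundle no vec_syntax

text \<open>
  Up to the sign \<open>(-1)^n\<close>, the Taylor coefficients of the function are
  \<open>c\<^sub>n = \<Prod>j<n. 1 / \<phi> j\<close> with $\varphi(x) = \frac{1+x}{\sigma+x}\prod_i \frac{b_i+x}{a_i+x}$.
  Multiplication by $1/(a+n)$ preserves positivity of the Hankel forms of a sequence, and weak
  supermajorization lets $\varphi$ be factored into pieces $1 + C/(a+x)$ and
  $1 + C/((a+x)(a'+x))$ with \<open>C \<ge> 0\<close>, so multiplication by \<open>\<phi> (s + n)\<close> preserves positivity as
  well, strictly if some \<open>C > 0\<close>. Since \<open>\<phi>\<close> tends to 1, \<open>c\<^sub>n\<close> is the limit of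
  $\prod_{k<N} \varphi(n+k)/\varphi(k)$, hence \<open>c\<close> and its shift have positive definite Hankel forms.
  The coefficients of the reciprocal series inherit this (up to sign), because their Hankel
  matrices are congruent to those of \<open>c\<close>. Together, the two families of Hankel matrices rule out
  every degenerate Pade approximant, on or above and below the diagonal respectively.
\<close>

subsection \<open>Sequences with positive Hankel forms\<close>

text \<open>The linear functional with moments \<open>c i\<close>. Its value at \<open>p * p\<close>
  is the Hankel quadratic form of \<open>c\<close> at the coefficients of \<open>p\<close>, so that
  positivity becomes a matter of polynomial algebra.\<close>

definition moment_fun :: "(nat \<Rightarrow> real) \<Rightarrow> real poly \<Rightarrow> real" where
  "moment_fun c p = (\<Sum>i\<le>degree p. coeff p i * c i)"

definition hankel_psd :: "(nat \<Rightarrow> real) \<Rightarrow> bool" where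
  "hankel_psd c \<longleftrightarrow> (\<forall>p. 0 \<le> moment_fun c (p * p))"

definition hankel_pd :: "(nat \<Rightarrow> real) \<Rightarrow> bool" where
  "hankel_pd c \<longleftrightarrow> (\<forall>p. p \<noteq> 0 \<longrightarrow> 0 < moment_fun c (p * p))"

text \<open>Semidefiniteness alone admits the zero sequence; positive entries are what makes the
  conclusion of \<open>hankel_pd_divide\<close> strict.\<close>

definition pos_hankel :: "(nat \<Rightarrow> real) \<Rightarrow> bool" where
  "pos_hankel c \<longleftrightarrow> (\<forall>n. 0 < c n) \<and> hankel_psd c"

lemma moment_fun_bound:
  assumes "degree p \<le> N"
  shows "moment_fun c p = (\<Sum>i\<le>N. coeff p i * c i)"
  unfolding moment_fun_def using assms
  by (intro sum.mono_neutral_left) (auto simp: coeff_eq_0)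

lemma moment_fun_0 [simp]: "moment_fun c 0 = 0"
  by (simp add: moment_fun_def)

lemma moment_fun_add: "moment_fun c (p + q) = moment_fun c p + moment_fun c q"
proof -
  define N where "N = max (degree p) (degree q)"
  have "degree (p + q) \<le> N" "degree p \<le> N" "degree q \<le> N"
    unfolding N_def by (simp_all add: degree_add_le_max)
  then show ?thesis
    by (simp add: moment_fun_bound[of _ N] sum.distrib ring_distribs)
qed

lemma moment_fun_sum: "moment_fun c (\<Sum>i\<in>A. f i) = (\<Sum>i\<in>A. moment_fun c (f i))"
  by (induction A rule: infinite_finite_induct) (simp_all add: moment_fun_add)

lemma moment_fun_monom [simp]: "moment_fun c (monom a k) = a * c k"
proof -
  have "moment_fun c (monom a k) = (\<Sum>i\<le>k. coeff (monom a k) i * c i)"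
    by (intro moment_fun_bound degree_monom_le)
  also have "\<dots> = (\<Sum>i\<le>k. if i = k then a * c k else 0)"
    by (intro sum.cong) auto
  finally show ?thesis by simp
qed

lemma moment_fun_smult: "moment_fun c (smult a p) = a * moment_fun c p"
  using moment_fun_bound[of "smult a p" "degree p" c] degree_smult_le[of a p]
  by (simp add: moment_fun_def sum_distrib_left mult_ac)

lemma moment_fun_add_seq: "moment_fun (\<lambda>n. c n + d n) p = moment_fun c p + moment_fun d p"
  by (simp add: moment_fun_def sum.distrib ring_distribs)

lemma moment_fun_cmult_seq: "moment_fun (\<lambda>n. a * c n) p = a * moment_fun c p"
  by (simp add: moment_fun_def sum_distrib_left mult_ac)

lemma moment_fun_square:
  "moment_fun c ((\<Sum>i<n. monom (x i) i) * (\<Sum>i<n. monom (x i) i)) =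
     (\<Sum>i<n. \<Sum>j<n. x i * x j * c (i + j))"
  by (simp add: sum_product moment_fun_sum mult_monom)

lemma moment_fun_monom_mult: "moment_fun c (monom 1 k * p) = moment_fun (\<lambda>n. c (k + n)) p"
proof -
  have "moment_fun c (monom 1 k * (\<Sum>i\<le>degree p. monom (coeff p i) i)) =
     moment_fun (\<lambda>n. c (k + n)) (\<Sum>i\<le>degree p. monom (coeff p i) i)"
    by (simp add: sum_distrib_left moment_fun_sum mult_monom)
  then show ?thesis by (simp add: poly_as_sum_of_monoms)
qed

lemma hankel_pd_imp_psd: "hankel_pd c \<Longrightarrow> hankel_psd c"
  unfolding hankel_pd_def hankel_psd_def
  by (metis less_eq_real_def moment_fun_0 mult_zero_left)

lemma hankel_pd_add: "hankel_psd c \<Longrightarrow> hankel_pd d \<Longrightarrow> hankel_pd (\<lambda>n. c n + d n)"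
  by (simp add: hankel_pd_def hankel_psd_def moment_fun_add_seq add_nonneg_pos)

lemma hankel_pd_cmult: "0 < a \<Longrightarrow> hankel_pd c \<Longrightarrow> hankel_pd (\<lambda>n. a * c n)"
  by (simp add: hankel_pd_def moment_fun_cmult_seq)

lemma hankel_psd_cmult: "0 \<le> a \<Longrightarrow> hankel_psd c \<Longrightarrow> hankel_psd (\<lambda>n. a * c n)"
  by (simp add: hankel_psd_def moment_fun_cmult_seq)

text \<open>Each form involves finitely many entries, so pointwise convergence suffices. Strictness
  may be lost in the limit; \<open>hankel_pd_ratio_seq\<close> recovers it.\<close>

lemma hankel_psd_limit:
  assumes "\<And>N. hankel_psd (c N)" "\<And>n. (\<lambda>N. c N n) \<longlonglongrightarrow> d n"
  shows "hankel_psd d"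
  unfolding hankel_psd_def
proof
  fix p :: "real poly"
  have "(\<lambda>N. moment_fun (c N) (p * p)) \<longlonglongrightarrow> moment_fun d (p * p)"
    unfolding moment_fun_def by (intro tendsto_intros assms)
  then show "0 \<le> moment_fun d (p * p)"
    using assms(1) unfolding hankel_psd_def by (intro LIMSEQ_le_const) auto
qed

text \<open>The functional of this sequence is evaluation at 1, where squares are
  nonnegative.\<close>

lemma pos_hankel_const: "pos_hankel (\<lambda>_. 1)"
proof -
  have "moment_fun (\<lambda>_. 1) p = poly p 1" for p
    by (simp add: moment_fun_def poly_altdef)
  then show ?thesis by (simp add: pos_hankel_def hankel_psd_def)
qed

text \<open>Replacing \<open>p\<close> by \<open>x^k p\<close> multiplies its square by
  \<open>x^(2k)\<close>, which shifts the moments by \<open>2k\<close>.\<close>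

lemma hankel_pd_shift_even:
  assumes "hankel_pd c"
  shows "hankel_pd (\<lambda>n. c (2 * k + n))"
  unfolding hankel_pd_def
proof (intro allI impI)
  fix p :: "real poly" assume "p \<noteq> 0"
  then have "0 < moment_fun c ((monom 1 k * p) * (monom 1 k * p))"
    using assms unfolding hankel_pd_def by simp
  also have "(monom 1 k * p) * (monom 1 k * p) = monom 1 (2 * k) * (p * p)"
  proof -
    have "monom 1 (2 * k) = monom 1 k * monom (1::real) k"
      by (simp add: mult_monom mult_2)
    then show ?thesis by (simp only: mult_ac)
  qed
  finally show "0 < moment_fun (\<lambda>n. c (2 * k + n)) (p * p)"
    by (simp only: moment_fun_monom_mult)
qed

text \<open>Since $1/(a+n) = \int_0^1 t^{a+n-1}\,dt$, the form of the new sequence at \<open>p\<close> is the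
  integral of $t^{a-1}$ times the form of \<open>c\<close> at the rescaled polynomial $p(t\,\cdot)$; the
  argument below replaces the integral by monotonicity of its primitive.\<close>
lemma hankel_pd_divide:
  assumes c: "pos_hankel c" and a: "0 < a"
  shows "hankel_pd (\<lambda>n. c n / (a + real n))"
  unfolding hankel_pd_def
proof (intro allI impI)
  fix p :: "real poly" assume p: "p \<noteq> 0"
  define r where "r = p * p"
  have r: "r \<noteq> 0" using p by (simp add: r_def)
  define s where "s = (\<Sum>i\<le>degree r. monom (coeff r i * c i) i)"
  have "coeff s (degree r) = coeff r (degree r) * c (degree r)"
    by (simp add: s_def coeff_sum sum.delta)
  moreover have "c (degree r) > 0" using c by (simp add: pos_hankel_def)
  ultimately have "s \<noteq> 0" using r by auto
  have s_poly: "poly s t = (\<Sum>i\<le>degree r. coeff r i * c i * t ^ i)" for t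
    by (simp add: s_def poly_sum poly_monom)
  have s_nonneg: "0 \<le> poly s t" for t
  proof -
    define pt where "pt = pcompose p [:0, t:]"
    have "pt * pt = pcompose r [:0, t:]"
      by (simp add: pt_def r_def pcompose_mult)
    then have "0 \<le> moment_fun c (pcompose r [:0, t:])"
      using c by (metis pos_hankel_def hankel_psd_def)
    also have "\<dots> = (\<Sum>i\<le>degree r. coeff (pcompose r [:0, t:]) i * c i)"
      using degree_pcompose_le[of r "[:0, t:]"] by (intro moment_fun_bound) (auto split: if_splits)
    also have "\<dots> = poly s t"
      by (simp add: s_poly coeff_pcompose_linear mult_ac)
    finally show ?thesis .
  qed
  \<comment> \<open>\<open>G\<close> is the primitive of \<open>t powr (a - 1) * poly s t\<close>
    that vanishes at 0; its value at 1 is the form of the new sequence.\<close>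
  define G where "G t = (\<Sum>i\<le>degree r. coeff r i * (c i / (a + real i)) * t powr (a + real i))" for t
  have dG: "(G has_real_derivative t powr (a - 1) * poly s t) (at t)" if "t > 0" for t
  proof -
    have "((\<lambda>t. coeff r i * (c i / (a + real i)) * t powr (a + real i)) has_real_derivative
        t powr (a - 1) * (coeff r i * c i * t ^ i)) (at t)" for i
    proof -
      have "t powr (a + real i - 1) = t powr (a - 1) * t ^ i"
        using that by (simp add: powr_add[symmetric] powr_realpow[symmetric] algebra_simps)
      moreover have "a + real i \<noteq> 0" using a by linarith
      ultimately show ?thesis
        using that by (auto intro!: derivative_eq_intros)
    qed
    then show ?thesis
      unfolding G_def[abs_def] s_poly sum_distrib_left by (intro DERIV_sum) 
  qed
  have cG: "continuous_on {0..1} G"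
    unfolding G_def[abs_def] using a
    by (intro continuous_on_sum continuous_on_mult continuous_on_const continuous_on_powr'
        continuous_on_id) (auto simp: add_pos_nonneg)
  have mono: "G u \<le> G v" if "0 \<le> u" "u \<le> v" "v \<le> 1" for u v
  proof (rule DERIV_nonneg_imp_increasing_open[OF that(2)])
    show "continuous_on {u..v} G" using cG that by (rule_tac continuous_on_subset) auto
    fix x assume "u < x" "x < v"
    with that have "x > 0" by simp
    with dG show "\<exists>y. (G has_real_derivative y) (at x) \<and> 0 \<le> y"
      using s_nonneg by (meson mult_nonneg_nonneg powr_ge_zero)
  qed
  \<comment> \<open>As \<open>s\<close> has finitely many zeros, the integrand is positive at some
    \<open>t\<close> in (0,1). Strict growth of \<open>G\<close> there gives
    \<open>G 0 < G 1\<close>.\<close>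
  have "infinite ({0<..<1::real} - {t. poly s t = 0})"
    using poly_roots_finite[OF \<open>s \<noteq> 0\<close>] infinite_Ioo[of 0 "1::real"] Diff_infinite_finite
    by fastforce
  then have "{0<..<1::real} - {t. poly s t = 0} \<noteq> {}"
    by (rule infinite_imp_nonempty)
  then obtain t where "t \<in> {0<..<1::real} - {t. poly s t = 0}"
    by blast
  then have t: "0 < t" "t < 1" "poly s t \<noteq> 0"
    by auto
  then have "0 < t powr (a - 1) * poly s t"
    using s_nonneg[of t] by simp
  from DERIV_pos_inc_right[OF dG[OF t(1)] this] obtain d where
    d: "d > 0" "\<And>h. 0 < h \<Longrightarrow> h < d \<Longrightarrow> G t < G (t + h)" by auto
  define h where "h = min (d / 2) (1 - t)"
  have "0 = G 0" by (simp add: G_def)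
  also have "\<dots> \<le> G t" using t by (intro mono) auto
  also have "G t < G (t + h)" using d t by (intro d(2)) (auto simp: h_def)
  also have "\<dots> \<le> G 1" using d t by (intro mono) (auto simp: h_def)
  also have "G 1 = moment_fun (\<lambda>n. c n / (a + real n)) r"
    by (simp add: G_def moment_fun_def)
  finally show "0 < moment_fun (\<lambda>n. c n / (a + real n)) (p * p)"
    by (simp add: r_def)
qed

section \<open>Functions acting as multipliers on positive sequences\<close>

definition pd_multiplier :: "(real \<Rightarrow> real) \<Rightarrow> bool" where
  "pd_multiplier \<phi> \<longleftrightarrow> (\<forall>x\<ge>0. 0 < \<phi> x) \<and>
     (\<forall>s c. 0 \<le> s \<longrightarrow> pos_hankel c \<longrightarrow> hankel_pd (\<lambda>n. \<phi> (s + real n) * c n))"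

text \<open>Both notions quantify over all offsets \<open>s\<close>, because the coefficient
  sequence is built by multiplying with translates of one function.\<close>

definition psd_multiplier :: "(real \<Rightarrow> real) \<Rightarrow> bool" where
  "psd_multiplier \<phi> \<longleftrightarrow> (\<forall>x\<ge>0. 0 < \<phi> x) \<and>
     (\<forall>s c. 0 \<le> s \<longrightarrow> pos_hankel c \<longrightarrow> hankel_psd (\<lambda>n. \<phi> (s + real n) * c n))"

lemma pd_multiplier_imp_psd: "pd_multiplier \<phi> \<Longrightarrow> psd_multiplier \<phi>"
  by (auto simp: pd_multiplier_def psd_multiplier_def intro: hankel_pd_imp_psd)

lemma psd_multiplierD:
  "psd_multiplier \<phi> \<Longrightarrow> 0 \<le> s \<Longrightarrow> pos_hankel c \<Longrightarrow> pos_hankel (\<lambda>n. \<phi> (s + real n) * c n)"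
  by (auto simp: psd_multiplier_def pos_hankel_def)

lemma pd_multiplier_cong:
  assumes "\<And>x. 0 \<le> x \<Longrightarrow> \<phi> x = \<psi> x"
  shows "pd_multiplier \<phi> \<longleftrightarrow> pd_multiplier \<psi>"
  unfolding pd_multiplier_def using assms by (auto cong: imp_cong)

text \<open>The factor \<open>\<psi>\<close> acts first and yields a \<open>pos_hankel\<close>
  sequence, on which \<open>\<phi>\<close> acts strictly; one strict factor is enough.\<close>

lemma pd_multiplier_mult:
  assumes "pd_multiplier \<phi>" "psd_multiplier \<psi>"
  shows "pd_multiplier (\<lambda>x. \<phi> x * \<psi> x)"
  using assms psd_multiplierD[OF assms(2)]
  by (auto simp: psd_multiplier_def pd_multiplier_def mult.assoc)

text \<open>The function is \<open>1 + (b - a) / (a + x)\<close>: the identity plus a positive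
  multiple of a division.\<close>

lemma pd_multiplier_ratio:
  assumes "0 < a" "a < b"
  shows "pd_multiplier (\<lambda>x. (b + x) / (a + x))"
  unfolding pd_multiplier_def
proof (intro conjI allI impI)
  fix s :: real and c assume s: "0 \<le> s" and c: "pos_hankel c"
  have "hankel_pd (\<lambda>n. c n + (b - a) * (c n / ((a + s) + real n)))"
    using assms s c by (intro hankel_pd_add hankel_pd_cmult hankel_pd_divide) (auto simp: pos_hankel_def)
  also have "(\<lambda>n. c n + (b - a) * (c n / ((a + s) + real n))) =
      (\<lambda>n. (b + (s + real n)) / (a + (s + real n)) * c n)"
  proof
    fix n
    have "a + s + real n \<noteq> 0" using assms s by linarith
    then show "c n + (b - a) * (c n / ((a + s) + real n)) = (b + (s + real n)) / (a + (s + real n)) * c n"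
      by (simp add: divide_simps add_ac) (simp add: algebra_simps)
  qed
  finally show "hankel_pd (\<lambda>n. (b + (s + real n)) / (a + (s + real n)) * c n)" .
qed (use assms in auto)

text \<open>Because the sums agree, numerator and denominator differ by the constant
  \<open>b * b' - a * a'\<close>. The ratio is therefore 1 plus a positive multiple of two
  successive divisions.\<close>

lemma pd_multiplier_spread:
  assumes "0 < a" "0 < a'" "a + a' = b + b'" "a * a' < b * b'" "0 < b" "0 < b'"
  shows "pd_multiplier (\<lambda>x. (b + x) * (b' + x) / ((a + x) * (a' + x)))"
  unfolding pd_multiplier_def
proof (intro conjI allI impI)
  fix s :: real and c assume s: "0 \<le> s" and c: "pos_hankel c"
  have pos: "0 < a + s + real n" "0 < a' + s + real n" for n using assms s by linarith+
  have c': "pos_hankel (\<lambda>n. c n / (a + s + real n))"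
    using pos c hankel_pd_imp_psd[OF hankel_pd_divide[OF c, of "a + s"]] assms s
    by (auto simp: pos_hankel_def)
  have "hankel_pd (\<lambda>n. c n + (b * b' - a * a') * (c n / (a + s + real n) / ((a' + s) + real n)))"
    using assms s c by (intro hankel_pd_add hankel_pd_cmult hankel_pd_divide c') (auto simp: pos_hankel_def)
  also have "(\<lambda>n. c n + (b * b' - a * a') * (c n / (a + s + real n) / ((a' + s) + real n))) =
      (\<lambda>n. (b + (s + real n)) * (b' + (s + real n)) / ((a + (s + real n)) * (a' + (s + real n))) * c n)"
  proof
    fix n
    have b': "b' = a + a' - b" using assms by simp
    show "c n + (b * b' - a * a') * (c n / (a + s + real n) / ((a' + s) + real n)) =
      (b + (s + real n)) * (b' + (s + real n)) / ((a + (s + real n)) * (a' + (s + real n))) * c n"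
      using pos[of n] unfolding b' by (simp add: divide_simps add_ac) (simp add: algebra_simps)
  qed
  finally show "hankel_pd (\<lambda>n. (b + (s + real n)) * (b' + (s + real n)) / ((a + (s + real n)) * (a' + (s + real n))) * c n)" .
qed (use assms in auto)

subsection \<open>Multipliers from weak supermajorization\<close>

text \<open>\<open>B\<close> stands on top: for the lists \<open>\<sigma> # A\<close> and
  \<open>1 # B\<close>, the value at \<open>n\<close> is the hypergeometric coefficient
  \<open>n\<close> divided by coefficient \<open>n + 1\<close>.\<close>

definition list_ratio :: "real list \<Rightarrow> real list \<Rightarrow> real \<Rightarrow> real" where
  "list_ratio A B x = (\<Prod>b\<leftarrow>B. b + x) / (\<Prod>a\<leftarrow>A. a + x)"

lemma list_ratio_Cons [simp]:
  "list_ratio (a # A) (b # B) x = (b + x) / (a + x) * list_ratio A B x"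
  by (simp add: list_ratio_def)

lemma prod_list_shift_pos:
  assumes "\<forall>a\<in>set A. 0 < a" "0 \<le> x"
  shows "0 < (\<Prod>a\<leftarrow>A. a + (x::real))"
  using assms by (induction A) (auto intro!: mult_pos_pos)

lemma list_ratio_self:
  assumes "\<forall>a\<in>set A. 0 < a" "0 \<le> x"
  shows "list_ratio A A x = 1"
  using prod_list_shift_pos[OF assms] by (simp add: list_ratio_def)

lemma tendsto_list_ratio:
  assumes "length A = length B"
  shows "(list_ratio A B \<longlongrightarrow> 1) at_top"
  using assms
proof (induction A B rule: list_induct2)
  case Nil
  then show ?case by (simp add: list_ratio_def)
next
  case (Cons a A b B)
  have "((\<lambda>x. (b + x) / (a + x)) \<longlongrightarrow> 1) at_top"
    by real_asymp
  from tendsto_mult[OF this Cons.IH] show ?case by simp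
qed

lemma psd_list_ratio:
  assumes "A = B \<or> pd_multiplier (list_ratio A B)" "\<forall>a\<in>set A. 0 < a"
  shows "psd_multiplier (list_ratio A B)"
  using assms(1)
proof
  assume "A = B"
  then show ?thesis
    using list_ratio_self[OF assms(2)]
    by (auto simp: psd_multiplier_def pos_hankel_def)
qed (rule pd_multiplier_imp_psd)

text \<open>Equal entries cancel, and any strict inequality contributes a strict factor from
  \<open>pd_multiplier_ratio\<close>.\<close>

lemma pd_multiplier_pointwise:
  assumes "list_all2 (\<le>) A B" "\<forall>a\<in>set A. 0 < a"
  shows "A = B \<or> pd_multiplier (list_ratio A B)"
  using assms
proof (induction rule: list_all2_induct)
  case Nil
  then show ?case by simp
next
  case (Cons a A b B)
  then have IH: "A = B \<or> pd_multiplier (list_ratio A B)" and a: "0 < a" by auto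
  have eq: "pd_multiplier (list_ratio (a # A) (b # B)) \<longleftrightarrow>
      pd_multiplier (\<lambda>x. (b + x) / (a + x) * list_ratio A B x)"
    by (intro pd_multiplier_cong) simp
  show ?case
  proof (cases "a = b")
    case True
    have "pd_multiplier (list_ratio (a # A) (b # B)) \<longleftrightarrow> pd_multiplier (list_ratio A B)"
      using a True by (intro pd_multiplier_cong) simp
    then show ?thesis using IH True by metis
  next
    case False
    then have "pd_multiplier (\<lambda>x. (b + x) / (a + x) * list_ratio A B x)"
      using Cons IH by (intro pd_multiplier_mult pd_multiplier_ratio psd_list_ratio) auto
    then show ?thesis using eq by simp
  qed
qed

lemma sum_list_le_length_mult:
  "(\<And>x. x \<in> set xs \<Longrightarrow> x \<le> (b::real)) \<Longrightarrow> sum_list xs \<le> real (length xs) * b"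
  by (induction xs) (auto simp: algebra_simps add_mono)

lemma length_mult_le_sum_list:
  "(\<And>x. x \<in> set xs \<Longrightarrow> (b::real) \<le> x) \<Longrightarrow> real (length xs) * b \<le> sum_list xs"
  by (induction xs) (auto simp: algebra_simps add_mono)

text \<open>The first entry \<open>b\<close> of \<open>B\<close> is cancelled by a transfer between \<open>a\<close> and the first entry
  \<open>y \<ge> b\<close> of \<open>A\<close>, which preserves \<open>a + y\<close> and turns \<open>a\<close> into \<open>b\<close>. This destroys the order of
  \<open>A\<close>, so only \<open>B\<close> is assumed to be sorted.\<close>
lemma pd_multiplier_list_ratio:
  assumes "length A = length B" "\<forall>a\<in>set A. 0 < a" "\<forall>b\<in>set B. 0 < b" "sorted B"
    "\<And>k. k \<le> length A \<Longrightarrow> sum_list (take k A) \<le> sum_list (take k B)"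
  shows "A = B \<or> pd_multiplier (list_ratio A B)"
  using assms
proof (induction B arbitrary: A)
  case Nil
  then show ?case by simp
next
  case (Cons b B)
  then obtain a A0 where A: "A = a # A0" by (cases A) auto
  have a: "0 < a" "a \<le> b" using Cons.prems(2) Cons.prems(5)[of 1] by (auto simp: A)
  have B: "\<forall>x\<in>set B. b \<le> x" "sorted B" "\<forall>x\<in>set B. 0 < x" using Cons.prems by auto
  have len: "length A0 = length B" using Cons.prems by (simp add: A)
  show ?case
  proof (cases "\<forall>x\<in>set A0. x < b")
    case True
    \<comment> \<open>All remaining entries of \<open>A\<close> lie below \<open>b\<close>, which is
      the least entry of \<open>b # B\<close>.\<close>
    have "list_all2 (\<le>) A0 B"
      unfolding list_all2_conv_all_nth using True B len by (metis less_le_not_le nth_mem order_trans)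
    then have "list_all2 (\<le>) A (b # B)" using a by (simp add: A)
    then show ?thesis using Cons.prems by (intro pd_multiplier_pointwise) auto
  next
    case False
    then have "\<exists>x\<in>set A0. b \<le> x" by (auto simp: not_less)
    from split_list_first_prop[OF this] obtain A1 y A2 where
      A0: "A0 = A1 @ y # A2" "b \<le> y" "\<forall>x\<in>set A1. \<not> b \<le> x" by auto
    define y' where "y' = y - (b - a)"
    define A' where "A' = A1 @ y' # A2"
    have y': "0 < y'" "0 < y" using a A0 by (simp_all add: y'_def)
    have A'_pos: "\<forall>x\<in>set A'. 0 < x" using Cons.prems(2) y' by (auto simp: A'_def A A0)
    have IH: "A' = B \<or> pd_multiplier (list_ratio A' B)"
    proof (rule Cons.IH)
      show "length A' = length B" using len by (simp add: A'_def A0)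
      fix k assume k: "k \<le> length A'"
      show "sum_list (take k A') \<le> sum_list (take k B)"
      proof (cases "k \<le> length A1")
        case True
        have "sum_list (take k A') = sum_list (take k A1)"
          using True by (simp add: A'_def)
        \<comment> \<open>Before \<open>y\<close> the two prefixes are separated by
          \<open>b\<close>: entries of \<open>A1\<close> lie below it, entries of \<open>B\<close>
          are at least \<open>b\<close>.\<close>
        also have "\<dots> \<le> real (length (take k A1)) * b"
          using A0(3) by (intro sum_list_le_length_mult) (auto dest!: in_set_takeD simp: less_imp_le not_le)
        also have "length (take k A1) = length (take k B)"
          using True len by (simp add: A0)
        also have "real (length (take k B)) * b \<le> sum_list (take k B)"
          using B by (intro length_mult_le_sum_list) (auto dest!: in_set_takeD)
        finally show ?thesis .
      next
        case False
        then obtain j where j: "k = length A1 + Suc j"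
          by (metis add_Suc_right less_imp_Suc_add not_le)
        \<comment> \<open>From \<open>y\<close> on, the transfer lowers the prefix sum by
          \<open>b - a\<close>, which balances the removal of \<open>a\<close> from \<open>A\<close>
          and of \<open>b\<close> from the other list.\<close>
        have "sum_list (take k A') = sum_list (take k A0) - (b - a)"
          by (simp add: A'_def A0 j y'_def)
        moreover have "sum_list (take (Suc k) A) \<le> sum_list (take (Suc k) (b # B))"
          using k len by (intro Cons.prems(5)) (simp add: A A'_def A0)
        ultimately show ?thesis by (simp add: A)
      qed
    qed (use A'_pos B in auto)
    have eq: "list_ratio A (b # B) x =
        (b + x) * (y' + x) / ((a + x) * (y + x)) * list_ratio A' B x" if "0 \<le> x" for x
      using that a y' A0(2) by (simp add: list_ratio_def A A'_def A0)
    show ?thesis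
    proof (cases "a < b \<and> b < y")
      case True
      have "0 < (b - a) * (y - b)" using True by simp
      then have "a * y < b * y'" by (simp add: y'_def algebra_simps)
      then have "pd_multiplier (\<lambda>x. (b + x) * (y' + x) / ((a + x) * (y + x)) * list_ratio A' B x)"
        using a y' A0(2) A'_pos IH
        by (intro pd_multiplier_mult pd_multiplier_spread psd_list_ratio) (auto simp: y'_def)
      then show ?thesis using pd_multiplier_cong[of "list_ratio A (b # B)", OF eq] by simp
    next
      case False
      \<comment> \<open>In a degenerate transfer the extra factor is 1, so strictness must come from
        \<open>A'\<close> and \<open>B\<close>. If \<open>a < b\<close>, then \<open>a\<close>
        survives in \<open>A'\<close> below every entry of \<open>B\<close>, so \<open>A'\<close>
        differs from \<open>B\<close>.\<close>
      then have "a = b \<and> y' = y \<or> a < b \<and> y = b \<and> y' = a"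
        using a A0(2) by (auto simp: y'_def)
      then have cases: "a = b \<and> A0 = A' \<or> a < b \<and> a \<in> set A'" 
        and eq': "\<And>x. 0 \<le> x \<Longrightarrow> list_ratio A (b # B) x = list_ratio A' B x"
        using eq a y' by (auto simp: A'_def A0)
      have "pd_multiplier (list_ratio A (b # B)) \<longleftrightarrow> pd_multiplier (list_ratio A' B)"
        using eq' by (rule pd_multiplier_cong)
      moreover have "A' \<noteq> B" if "a < b" "a \<in> set A'" using that B(1) by fastforce
      ultimately show ?thesis using IH cases A by metis
    qed
  qed
qed

section \<open>The coefficient sequence as a limit of products\<close>

definition ratio_seq :: "(real \<Rightarrow> real) \<Rightarrow> real \<Rightarrow> nat \<Rightarrow> real" where
  "ratio_seq \<phi> s n = (\<Prod>j<n. 1 / \<phi> (s + real j))"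

lemma prod_lessThan_add: "(\<Prod>k<m + n. g k) = (\<Prod>k<m. g k) * (\<Prod>k<n. g (m + k :: nat) :: real)"
  by (induction n) (simp_all add: mult_ac)

lemma ratio_seq_pos: "psd_multiplier \<phi> \<Longrightarrow> 0 \<le> s \<Longrightarrow> 0 < ratio_seq \<phi> s n"
  by (auto simp: ratio_seq_def psd_multiplier_def intro!: prod_pos)

lemma ratio_seq_Suc_arg:
  assumes "psd_multiplier \<phi>" "0 \<le> s"
  shows "ratio_seq \<phi> s (Suc n) = 1 / \<phi> s * ratio_seq \<phi> (s + 1) n"
  unfolding ratio_seq_def by (subst prod.lessThan_Suc_shift) (simp add: add_ac)

lemma pos_hankel_ratio_seq:
  assumes \<phi>: "psd_multiplier \<phi>" "(\<phi> \<longlongrightarrow> 1) at_top" and s: "0 \<le> s"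
  shows "pos_hankel (ratio_seq \<phi> s)"
proof -
  have \<phi>_pos: "0 < \<phi> (s + real k)" for k
    using \<phi>(1) s by (auto simp: psd_multiplier_def)
  define c where "c N n = (\<Prod>k<N. \<phi> (s + real k + real n))" for N n
  have c: "pos_hankel (c N)" for N
  proof (induction N)
    case 0
    show ?case using pos_hankel_const by (simp add: c_def[abs_def])
  next
    case (Suc N)
    have "c (Suc N) = (\<lambda>n. \<phi> (s + real N + real n) * c N n)"
      by (simp add: c_def fun_eq_iff mult.commute)
    then show ?case using psd_multiplierD[OF \<phi>(1) _ Suc, of "s + real N"] s by simp
  qed
  define u where "u N = (\<Prod>k<N. \<phi> (s + real k))" for N
  have u_pos: "0 < u N" for N unfolding u_def using \<phi>_pos by (intro prod_pos) auto
  have "hankel_psd (ratio_seq \<phi> s)"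
  proof (rule hankel_psd_limit)
    show "hankel_psd (\<lambda>n. 1 / u N * c N n)" for N
      using c[of N] u_pos[of N] by (intro hankel_psd_cmult) (auto simp: pos_hankel_def)
    fix n
    have "1 / u N * c N n = ratio_seq \<phi> s n * (\<Prod>k<n. \<phi> (s + real k + real N))" for N
    proof -
      \<comment> \<open>The product of the first \<open>n + N\<close> values of
        \<open>\<phi>\<close> is split once after \<open>n\<close> factors and once after
        \<open>N\<close>.\<close>
      have "u n * c N n = (\<Prod>k<n + N. \<phi> (s + real k))"
        unfolding prod_lessThan_add by (simp add: u_def c_def add_ac)
      also have "\<dots> = (\<Prod>k<N + n. \<phi> (s + real k))" by (simp add: add.commute)
      also have "\<dots> = u N * (\<Prod>k<n. \<phi> (s + real k + real N))"
        unfolding prod_lessThan_add by (simp add: u_def add_ac)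
      finally have "u n * c N n = u N * (\<Prod>k<n. \<phi> (s + real k + real N))" .
      moreover have r: "ratio_seq \<phi> s n = 1 / u n"
        by (simp add: ratio_seq_def u_def prod_dividef)
      ultimately show ?thesis
        unfolding r using u_pos[of n] u_pos[of N] by (simp add: field_simps)
    qed
    moreover have "(\<lambda>N. ratio_seq \<phi> s n * (\<Prod>k<n. \<phi> (s + real k + real N)))
        \<longlonglongrightarrow> ratio_seq \<phi> s n * (\<Prod>k<n. 1)"
    proof (intro tendsto_intros filterlim_compose[OF \<phi>(2)])
      show "filterlim (\<lambda>N. s + real k + real N) at_top sequentially" for k
        by real_asymp
    qed
    ultimately show "(\<lambda>N. 1 / u N * c N n) \<longlonglongrightarrow> ratio_seq \<phi> s n" by simp
  qed
  then show ?thesis using ratio_seq_pos[OF \<phi>(1) s] by (simp add: pos_hankel_def)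
qed

text \<open>The sequence at \<open>s\<close> is, up to a positive constant, the one at
  \<open>s + 1\<close> multiplied once more by \<open>\<phi> (s + n)\<close>. This last
  multiplication restores strictness after the limit.\<close>

lemma hankel_pd_ratio_seq:
  assumes \<phi>: "pd_multiplier \<phi>" "(\<phi> \<longlongrightarrow> 1) at_top" and s: "0 \<le> s"
  shows "hankel_pd (ratio_seq \<phi> s)"
proof -
  have \<phi>': "psd_multiplier \<phi>" using \<phi>(1) by (rule pd_multiplier_imp_psd)
  have pos: "0 < \<phi> (s + real n)" for n
    using \<phi>(1) s by (auto simp: pd_multiplier_def)
  have "ratio_seq \<phi> s n = 1 / \<phi> s * (\<phi> (s + real n) * ratio_seq \<phi> (s + 1) n)" for n
  proof -
    have "ratio_seq \<phi> s (Suc n) = ratio_seq \<phi> s n / \<phi> (s + real n)"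
      by (simp add: ratio_seq_def)
    then show ?thesis
      using ratio_seq_Suc_arg[OF \<phi>' s, of n] pos[of n] pos[of 0] by (simp add: field_simps)
  qed
  then have "ratio_seq \<phi> s = (\<lambda>n. 1 / \<phi> s * (\<phi> (s + real n) * ratio_seq \<phi> (s + 1) n))" by blast
  moreover have "hankel_pd (\<lambda>n. 1 / \<phi> s * (\<phi> (s + real n) * ratio_seq \<phi> (s + 1) n))"
    using \<phi>(1) pos_hankel_ratio_seq[OF \<phi>' \<phi>(2), of "s + 1"] s pos[of 0]
    by (intro hankel_pd_cmult) (auto simp: pd_multiplier_def)
  ultimately show ?thesis by simp
qed

subsection \<open>Hankel forms of the reciprocal series\<close>

text \<open>The Hankel matrix of \<open>e\<close> is the Gram matrix of the polynomials
  \<open>T i\<close> under the form of \<open>c\<close>; these are independent because their degrees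
  are distinct.\<close>

lemma hankel_pd_transform:
  assumes c: "hankel_pd c"
    and T: "\<And>i j. moment_fun c (T i * T j) = e (i + j)"
    and deg: "\<And>i. degree (T i) = r + i" "\<And>i. T i \<noteq> 0"
  shows "hankel_pd e"
  unfolding hankel_pd_def
proof (intro allI impI)
  fix p :: "real poly" assume p: "p \<noteq> 0"
  define N where "N = degree p"
  define q where "q = (\<Sum>i\<le>N. smult (coeff p i) (T i))"
  have "coeff q (r + N) = (\<Sum>i\<le>N. if i = N then coeff p N * coeff (T N) (r + N) else 0)"
    unfolding q_def coeff_sum by (intro sum.cong) (auto intro!: coeff_eq_0 simp: deg)
  also have "\<dots> \<noteq> 0"
    using p deg[of N] by (simp add: N_def) (metis leading_coeff_0_iff)
  finally have "q \<noteq> 0" by auto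
  then have "0 < moment_fun c (q * q)" using c by (simp add: hankel_pd_def)
  also have "\<dots> = (\<Sum>i\<le>N. \<Sum>j\<le>N. coeff p i * coeff p j * e (i + j))"
    by (simp add: q_def sum_product moment_fun_sum moment_fun_smult T mult_ac)
  also have "\<dots> = moment_fun e ((\<Sum>i\<le>N. monom (coeff p i) i) * (\<Sum>j\<le>N. monom (coeff p j) j))"
    by (simp add: sum_product moment_fun_sum mult_monom)
  finally show "0 < moment_fun e (p * p)"
    by (simp add: N_def poly_as_sum_of_monoms)
qed

lemma fps_shift_1_mult:
  fixes f g :: "'a :: field fps"
  shows "fps_shift 1 (f * g) = fps_const (g $ 0) * fps_shift 1 f + f * fps_shift 1 g"
proof -
  have g: "g = fps_const (g $ 0) + fps_X * fps_shift 1 g"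
    by (rule fps_ext) (simp add: fps_X_mult_nth)
  have "f * g = fps_const (g $ 0) * f + fps_X * (f * fps_shift 1 g)"
    by (subst g) (simp add: algebra_simps)
  moreover have "fps_shift 1 (fps_const (g $ 0) * f) = fps_const (g $ 0) * fps_shift 1 f"
    "fps_shift 1 (fps_X * (f * fps_shift 1 g)) = f * fps_shift 1 g"
    by (rule fps_ext, simp)+
  ultimately show ?thesis by (simp only: fps_shift_add)
qed

text \<open>Repeated use of the product rule \<open>fps_shift_1_mult\<close>, starting from the
  shift of \<open>f * inverse f = 1\<close>.\<close>

lemma sum_inverse_coeff_shift:
  fixes f :: "'a :: field fps"
  assumes "f $ 0 \<noteq> 0"
  shows "(\<Sum>l\<le>j. fps_const (inverse f $ (j - l)) * fps_shift (Suc l) f) =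
     - (f * fps_shift (Suc j) (inverse f))"
proof (induction j)
  case 0
  have "fps_shift 1 (f * inverse f) = 0"
    using inverse_mult_eq_1'[OF assms] by (simp add: fps_shift_one)
  then show ?case
    unfolding fps_shift_1_mult by (simp add: add_eq_0_iff2)
next
  case (Suc j)
  define D where "D = inverse f"
  have "(\<Sum>l\<le>Suc j. fps_const (D $ (Suc j - l)) * fps_shift (Suc l) f) =
      fps_const (D $ Suc j) * fps_shift 1 f + (\<Sum>l\<le>j. fps_const (D $ (j - l)) * fps_shift (Suc (Suc l)) f)"
    by (subst sum.atMost_Suc_shift) simp
  also have "(\<Sum>l\<le>j. fps_const (D $ (j - l)) * fps_shift (Suc (Suc l)) f) =
      fps_shift 1 (\<Sum>l\<le>j. fps_const (D $ (j - l)) * fps_shift (Suc l) f)"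
    by (rule fps_ext) (simp add: fps_sum_nth)
  also have "(\<Sum>l\<le>j. fps_const (D $ (j - l)) * fps_shift (Suc l) f) = - (f * fps_shift (Suc j) D)"
    unfolding D_def by (rule Suc.IH)
  also have "fps_shift 1 (- (f * fps_shift (Suc j) D)) =
      - (fps_const (D $ Suc j) * fps_shift 1 f + f * fps_shift (Suc (Suc j)) D)"
  proof -
    have "fps_shift 1 (fps_shift (Suc j) D) = fps_shift (Suc (Suc j)) D"
      by (rule fps_ext) simp
    then show ?thesis by (simp only: fps_shift_uminus fps_shift_1_mult) simp
  qed
  finally show ?case by (simp add: D_def)
qed

text \<open>\<open>T i\<close> is the coefficient of \<open>y^i\<close> in
  \<open>1 / (f(y) (1 - x y))\<close>.\<close>

context
  fixes f :: "real fps" and T :: "nat \<Rightarrow> real poly"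
  assumes f0: "f $ 0 \<noteq> 0"
  defines "T \<equiv> \<lambda>i. \<Sum>k\<le>i. monom (inverse f $ (i - k)) k"
begin

lemma coeff_T: "coeff (T i) k = (if k \<le> i then inverse f $ (i - k) else 0)"
  by (simp add: T_def coeff_sum)

lemma degree_T: "degree (T i) = i"
proof (rule antisym)
  show "degree (T i) \<le> i" by (rule degree_le) (simp add: coeff_T)
  show "i \<le> degree (T i)" using f0 by (intro le_degree) (simp add: coeff_T)
qed

lemma T_nonzero: "T i \<noteq> 0"
  using f0 coeff_T[of i i] by auto

text \<open>The sum over the monomials of \<open>T i\<close> is a convolution with
  \<open>inverse f\<close>, read off at index \<open>i\<close>.\<close>

lemma moment_fun_T_mult:
  "moment_fun (\<lambda>n. f $ (r + n)) (T i * T j) =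
     (inverse f * (\<Sum>l\<le>j. fps_const (inverse f $ (j - l)) * fps_shift (r + l) f)) $ i"
proof -
  have "moment_fun (\<lambda>n. f $ (r + n)) (T i * T j) =
    (\<Sum>k\<le>i. \<Sum>l\<le>j. inverse f $ (i - k) * (inverse f $ (j - l) * f $ (r + (k + l))))"
    by (simp add: T_def sum_product moment_fun_sum mult_monom mult.assoc)
  also have "\<dots> = (\<Sum>k\<le>i. (\<Sum>l\<le>j. fps_const (inverse f $ (j - l)) * fps_shift (r + l) f) $ k *
      inverse f $ (i - k))"
    by (simp add: fps_sum_nth sum_distrib_left sum_distrib_right mult_ac add_ac)
  also have "\<dots> = ((\<Sum>l\<le>j. fps_const (inverse f $ (j - l)) * fps_shift (r + l) f) * inverse f) $ i"
    by (simp only: fps_mult_nth atLeast0AtMost)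
  finally show ?thesis by (simp only: mult.commute)
qed

text \<open>With \<open>H_c\<close> the generating function of the Hankel matrix of \<open>c\<close>, the Hankel matrix of the
  shifted negated coefficients of \<open>1/f\<close> has generating function
  $H_{Sc}(x,y) / (f(x) f(y))$, so it is congruent to the Hankel matrix of the shift \<open>Sc\<close>;
  the polynomials \<open>T i\<close> are the rows of the congruence.\<close>
lemma hankel_pd_inverse_1:
  assumes "hankel_pd (\<lambda>n. f $ (1 + n))"
  shows "hankel_pd (\<lambda>n. - (inverse f $ (n + 1)))"
proof (rule hankel_pd_transform[OF assms, of T _ 0])
  fix i j
  have "moment_fun (\<lambda>n. f $ (1 + n)) (T i * T j) =
      (inverse f * (\<Sum>l\<le>j. fps_const (inverse f $ (j - l)) * fps_shift (1 + l) f)) $ i"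
    by (rule moment_fun_T_mult)
  also have "(\<Sum>l\<le>j. fps_const (inverse f $ (j - l)) * fps_shift (1 + l) f) =
      - (f * fps_shift (Suc j) (inverse f))"
    using sum_inverse_coeff_shift[OF f0, of j] by simp
  also have "inverse f * (- (f * fps_shift (Suc j) (inverse f))) = - ((inverse f * f) * fps_shift (Suc j) (inverse f))"
    by (simp add: mult_ac)
  also have "\<dots> = - fps_shift (Suc j) (inverse f)" using inverse_mult_eq_1[OF f0] by simp
  finally show "moment_fun (\<lambda>n. f $ (1 + n)) (T i * T j) = - (inverse f $ (i + j + 1))"
    by simp
qed (simp_all add: degree_T T_nonzero)

text \<open>Without the initial shift of \<open>f\<close>, a constant series is left over. Using
  \<open>T (Suc i)\<close> reads coefficients at positive indices only, where that constant
  vanishes.\<close>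

lemma hankel_pd_inverse_2:
  assumes "hankel_pd (\<lambda>n. f $ n)"
  shows "hankel_pd (\<lambda>n. - (inverse f $ (n + 2)))"
proof (rule hankel_pd_transform[OF assms, of "\<lambda>i. T (Suc i)" _ 1])
  fix i j
  have *: "(\<Sum>l\<le>Suc j. fps_const (inverse f $ (Suc j - l)) * fps_shift l f) =
      fps_const (inverse f $ Suc j) * f - f * fps_shift (Suc j) (inverse f)"
    using sum_inverse_coeff_shift[OF f0, of j] by (subst sum.atMost_Suc_shift) simp
  have "inverse f * (\<Sum>l\<le>Suc j. fps_const (inverse f $ (Suc j - l)) * fps_shift l f) =
      (inverse f * f) * (fps_const (inverse f $ Suc j) - fps_shift (Suc j) (inverse f))"
    unfolding * by (simp only: algebra_simps)
  also have "\<dots> = fps_const (inverse f $ Suc j) - fps_shift (Suc j) (inverse f)"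
    using inverse_mult_eq_1[OF f0] by simp
  finally show "moment_fun (\<lambda>n. f $ n) (T (Suc i) * T (Suc j)) = - (inverse f $ (i + j + 2))"
    using moment_fun_T_mult[of 0 "Suc i" "Suc j"] by simp
qed (simp_all add: degree_T T_nonzero)

end

section \<open>Nonsingularity of complex Hankel matrices\<close>

definition hankel_regular :: "(nat \<Rightarrow> complex) \<Rightarrow> bool" where
  "hankel_regular e \<longleftrightarrow>
     (\<forall>k n x. (\<forall>i<n. (\<Sum>j<n. e (k + i + j) * x j) = 0) \<longrightarrow> (\<forall>j<n. x j = 0))"

lemma hankel_pd_kernel:
  assumes "hankel_pd c" "\<And>i. i < n \<Longrightarrow> (\<Sum>j<n. c (i + j) * x j) = 0" "j < n"
  shows "x j = 0"
proof -
  define p where "p = (\<Sum>i<n. monom (x i) i)"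
  have "moment_fun c (p * p) = (\<Sum>i<n. x i * (\<Sum>j<n. c (i + j) * x j))"
    unfolding p_def moment_fun_square by (simp add: sum_distrib_left mult_ac)
  also have "\<dots> = 0" using assms(2) by simp
  finally have "p = 0" using assms(1) unfolding hankel_pd_def by force
  moreover have "coeff p j = x j" using assms(3) by (simp add: p_def coeff_sum)
  ultimately show ?thesis by simp
qed

text \<open>Even offsets reduce to \<open>c\<close>, odd ones to its shift. The factors
  \<open>a * s ^ n\<close> are absorbed by rescaling the unknowns, whose real and imaginary parts
  then solve the same real system.\<close>

lemma hankel_regularI:
  assumes c: "hankel_pd c" "hankel_pd (\<lambda>n. c (n + 1))" and a: "a \<noteq> 0" "s \<noteq> 0"
  shows "hankel_regular (\<lambda>n. a * s ^ n * of_real (c n))"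
  unfolding hankel_regular_def
proof (intro allI impI)
  fix k n j :: nat and x :: "nat \<Rightarrow> complex"
  assume x: "\<forall>i<n. (\<Sum>j<n. a * s ^ (k + i + j) * of_real (c (k + i + j)) * x j) = 0" and j: "j < n"
  have pd: "hankel_pd (\<lambda>i. c (k + i))"
  proof (cases "even k")
    case True
    then show ?thesis using hankel_pd_shift_even[OF c(1), of "k div 2"] by simp
  next
    case False
    then obtain l where "k = 2 * l + 1" by (rule oddE)
    then show ?thesis using hankel_pd_shift_even[OF c(2), of l] by (simp add: add_ac)
  qed
  define y where "y j = s ^ j * x j" for j
  have y: "(\<Sum>j<n. of_real (c (k + (i + j))) * y j) = 0" if "i < n" for i
  proof -
    have "a * s ^ (k + i) * (\<Sum>j<n. of_real (c (k + (i + j))) * y j) =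
        (\<Sum>j<n. a * s ^ (k + i + j) * of_real (c (k + i + j)) * x j)"
      unfolding sum_distrib_left
      by (intro sum.cong) (simp_all add: y_def power_add mult_ac add.assoc)
    also have "\<dots> = 0" using x that by simp
    finally show ?thesis using a by simp
  qed
  have "Re (y j) = 0"
  proof (rule hankel_pd_kernel[OF pd _ j, of "\<lambda>j. Re (y j)"])
    fix i assume "i < n"
    then show "(\<Sum>j<n. c (k + (i + j)) * Re (y j)) = 0" using arg_cong[OF y, of i Re] by simp
  qed
  moreover have "Im (y j) = 0"
  proof (rule hankel_pd_kernel[OF pd _ j, of "\<lambda>j. Im (y j)"])
    fix i assume "i < n"
    then show "(\<Sum>j<n. c (k + (i + j)) * Im (y j)) = 0" using arg_cong[OF y, of i Im] by simp
  qed
  ultimately have "y j = 0" by (simp add: complex_eq_iff)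
  then show "x j = 0" using a by (simp add: y_def)
qed

subsection \<open>Normality of the Pade table\<close>

text \<open>The degree bounds are strict (\<open>m = 0\<close> forces \<open>P = 0\<close>), so
  order \<open>m + n\<close> is one more than the entry \<open>(m - 1, n - 1)\<close> demands when
  \<open>m\<close> and \<open>n\<close> are positive.\<close>

definition pade_regular :: "complex fps \<Rightarrow> bool" where
  "pade_regular F \<longleftrightarrow> (\<forall>m n P Q. (\<forall>k\<ge>m. coeff P k = 0) \<longrightarrow> (\<forall>k\<ge>n. coeff Q k = 0) \<longrightarrow>
     (\<forall>k<m + n. (F * fps_of_poly Q - fps_of_poly P) $ k = 0) \<longrightarrow> Q = 0)"

definition pade_pair :: "complex fps \<Rightarrow> nat \<Rightarrow> nat \<Rightarrow> complex poly \<Rightarrow> complex poly \<Rightarrow> bool" where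
  "pade_pair F m n P Q \<longleftrightarrow> Q \<noteq> 0 \<and> degree P \<le> m \<and> degree Q \<le> n \<and>
     (\<forall>k<m + n + 1. (F * fps_of_poly Q - fps_of_poly P) $ k = 0)"

lemma fps_mult_nth_eq_0:
  fixes A B :: "'a :: semiring_0 fps"
  assumes "\<forall>k<K. A $ k = 0"
  shows "\<forall>k<K. (B * A) $ k = 0"
  using assms by (auto simp: fps_mult_nth intro!: sum.neutral)

text \<open>Coefficients \<open>m\<close> to \<open>m + n - 1\<close> of \<open>G Q\<close> vanish:
  \<open>n\<close> equations for the \<open>n\<close> coefficients of \<open>Q\<close>. Reversing
  their order turns this Toeplitz system into a Hankel one, with least index
  \<open>m - n + 1\<close>.\<close>

lemma hankel_regular_imp_zero:
  fixes G :: "complex fps"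
  assumes G: "hankel_regular (\<lambda>k. G $ (k + 1))" and mn: "n \<le> m"
    and P: "\<forall>k\<ge>m. coeff P k = 0" and Q: "\<forall>k\<ge>n. coeff Q k = 0"
    and GQP: "\<forall>k<m + n. (G * fps_of_poly Q - fps_of_poly P) $ k = 0"
  shows "Q = 0"
proof -
  define x where "x j = coeff Q (n - Suc j)" for j
  have "(\<Sum>j<n. G $ (m - n + i + j + 1) * x j) = 0" if "i < n" for i
  proof -
    have "(\<Sum>j<n. G $ (m - n + i + j + 1) * x j) = (\<Sum>j<n. G $ (m + i - (n - Suc j)) * x j)"
      using mn by (intro sum.cong) (auto intro!: arg_cong[of _ _ "fps_nth G"])
    also have "\<dots> = (\<Sum>j<n. G $ (m + i - j) * coeff Q j)"
      unfolding x_def by (rule sum.nat_diff_reindex)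
    also have "\<dots> = (\<Sum>j<n. coeff Q j * G $ (m + i - j))"
      by (simp only: mult.commute)
    also have "\<dots> = (\<Sum>j\<le>m + i. coeff Q j * G $ (m + i - j))"
      using mn that Q by (intro sum.mono_neutral_left) auto
    also have "\<dots> = (fps_of_poly Q * G) $ (m + i)"
      by (simp add: fps_mult_nth atLeast0AtMost)
    also have "\<dots> = (G * fps_of_poly Q - fps_of_poly P) $ (m + i)"
      using P by (simp add: mult.commute)
    also have "\<dots> = 0" using GQP that by simp
    finally show ?thesis .
  qed
  then have x: "x j = 0" if "j < n" for j
    using G that unfolding hankel_regular_def by blast
  have "coeff Q k = 0" for k
    using x[of "n - Suc k"] Q by (cases "k < n") (auto simp: x_def)
  then show ?thesis by (simp add: poly_eq_iff)
qed

text \<open>Multiplication by \<open>inverse F\<close> exchanges \<open>P\<close> and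
  \<open>Q\<close>, so the case \<open>m < n\<close> reduces to the previous lemma for the
  reciprocal series.\<close>

lemma pade_regularI:
  fixes F :: "complex fps"
  assumes F: "hankel_regular (\<lambda>k. F $ (k + 1))" "hankel_regular (\<lambda>k. inverse F $ (k + 1))"
    and F0: "F $ 0 \<noteq> 0"
  shows "pade_regular F"
  unfolding pade_regular_def
proof (intro allI impI)
  fix m n P Q
  assume P: "\<forall>k\<ge>m. coeff P k = 0" and Q: "\<forall>k\<ge>n. coeff Q k = 0"
    and *: "\<forall>k<m + n. (F * fps_of_poly Q - fps_of_poly P) $ k = 0"
  show "Q = 0"
  proof (cases "n \<le> m")
    case True
    then show ?thesis using hankel_regular_imp_zero[OF F(1) _ P Q *] by simp
  next
    case False
    have "inverse F * (F * fps_of_poly Q - fps_of_poly P) = fps_of_poly Q - inverse F * fps_of_poly P"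
      using inverse_mult_eq_1[OF F0] by (simp add: right_diff_distrib flip: mult.assoc)
    then have **: "\<forall>k<m + n. (fps_of_poly Q - inverse F * fps_of_poly P) $ k = 0"
      using fps_mult_nth_eq_0[OF *, of "inverse F"] by simp
    then have "P = 0"
      using False by (intro hankel_regular_imp_zero[OF F(2) _ Q P]) (auto simp: add.commute)
    then have "coeff Q k = 0" for k
      using ** Q by (cases "k < n") auto
    then show ?thesis by (simp add: poly_eq_iff)
  qed
qed

section \<open>Existence and uniqueness of Pade fractions\<close>

lemma linear_system_nontrivial_solution:
  fixes a :: "'r \<Rightarrow> 'i \<Rightarrow> 'a :: field"
  assumes "finite R" "finite I" "card R < card I"
  shows "\<exists>x. (\<exists>i\<in>I. x i \<noteq> 0) \<and> (\<forall>r\<in>R. (\<Sum>i\<in>I. a r i * x i) = 0)"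
  using assms
proof (induction R arbitrary: I a rule: finite_induct)
  case empty
  then obtain i where "i \<in> I" by fastforce
  then show ?case by (intro exI[of _ "\<lambda>_. 1"]) auto
next
  case (insert r R)
  show ?case
  proof (cases "\<forall>i\<in>I. a r i = 0")
    case True
    have "card R < card I" using insert by simp
    then obtain x where "\<exists>i\<in>I. x i \<noteq> 0" "\<forall>r\<in>R. (\<Sum>i\<in>I. a r i * x i) = 0"
      using insert.IH[of I a] insert.prems(1) by blast
    then show ?thesis using True by (intro exI[of _ x]) auto
  next
    case False
    then obtain p where p: "p \<in> I" "a r p \<noteq> 0" by auto
    \<comment> \<open>Gaussian elimination: equation \<open>r\<close> removes the unknown
      \<open>p\<close> from the others, and later determines \<open>y p\<close>.\<close>
    define b where "b s i = a s i - a s p * a r i / a r p" for s i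
    have "card R < card (I - {p})" using insert p by auto
    then obtain x where x: "\<exists>i\<in>I - {p}. x i \<noteq> 0" "\<forall>s\<in>R. (\<Sum>i\<in>I - {p}. b s i * x i) = 0"
      using insert.IH[of "I - {p}" b] insert.prems by auto
    define S where "S = (\<Sum>i\<in>I - {p}. a r i * x i)"
    define y where "y = x(p := - S / a r p)"
    have y: "(\<Sum>i\<in>I. a s i * y i) = (\<Sum>i\<in>I - {p}. a s i * x i) - a s p * S / a r p" for s
    proof -
      have "(\<Sum>i\<in>I. a s i * y i) = a s p * y p + (\<Sum>i\<in>I - {p}. a s i * y i)"
        using p insert.prems by (intro sum.remove)
      also have "(\<Sum>i\<in>I - {p}. a s i * y i) = (\<Sum>i\<in>I - {p}. a s i * x i)"
        by (intro sum.cong) (auto simp: y_def)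
      finally show ?thesis by (simp add: y_def)
    qed
    have "(\<Sum>i\<in>I. a s i * y i) = 0" if "s \<in> insert r R" for s
    proof (cases "s = r")
      case True
      then show ?thesis unfolding y using p by (simp add: S_def)
    next
      case False
      have "(\<Sum>i\<in>I - {p}. b s i * x i) = (\<Sum>i\<in>I - {p}. a s i * x i) - a s p * S / a r p"
      proof -
        have "(\<Sum>i\<in>I - {p}. b s i * x i) =
            (\<Sum>i\<in>I - {p}. a s i * x i - a s p / a r p * (a r i * x i))"
          by (intro sum.cong) (simp_all add: b_def left_diff_distrib)
        also have "\<dots> = (\<Sum>i\<in>I - {p}. a s i * x i) - a s p / a r p * S"
          unfolding S_def sum_subtractf sum_distrib_left ..
        finally show ?thesis by simp
      qed
      then show ?thesis unfolding y using x(2) that False by auto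
    qed
    moreover have "\<exists>i\<in>I. y i \<noteq> 0" using x(1) by (auto simp: y_def)
    ultimately show ?thesis by blast
  qed
qed

text \<open>The coefficients \<open>m + 1\<close> to \<open>m + n\<close> of \<open>F Q\<close> must
  vanish, which is \<open>n\<close> equations for \<open>n + 1\<close> unknowns; \<open>P\<close> is
  then the truncation of \<open>F Q\<close>.\<close>

lemma pade_pair_exists: "\<exists>P Q. pade_pair F m n P Q"
proof -
  define a where "a r i = (if i \<le> m + 1 + r then F $ (m + 1 + r - i) else 0)" for r i
  obtain x where x: "\<exists>i\<in>{..n}. x i \<noteq> 0" "\<forall>r\<in>{..<n}. (\<Sum>i\<le>n. a r i * x i) = 0"
    using linear_system_nontrivial_solution[of "{..<n}" "{..n}" a] by auto
  define Q where "Q = (\<Sum>i\<le>n. monom (x i) i)"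
  have Q: "coeff Q i = (if i \<le> n then x i else 0)" for i by (simp add: Q_def coeff_sum)
  define P where "P = (\<Sum>i\<le>m. monom ((F * fps_of_poly Q) $ i) i)"
  have P: "coeff P i = (if i \<le> m then (F * fps_of_poly Q) $ i else 0)" for i
    by (simp add: P_def coeff_sum)
  have "(F * fps_of_poly Q - fps_of_poly P) $ k = 0" if "k < m + n + 1" for k
  proof (cases "k \<le> m")
    case True
    then show ?thesis by (simp add: P)
  next
    case False
    then obtain r where r: "k = m + 1 + r"
      by (metis Suc_eq_plus1 le_add_diff_inverse not_less_eq_eq)
    have "(F * fps_of_poly Q) $ k = (fps_of_poly Q * F) $ k" by (simp add: mult.commute)
    also have "\<dots> = (\<Sum>i\<le>k. coeff Q i * F $ (k - i))"
      by (simp add: fps_mult_nth atLeast0AtMost)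
    also have "\<dots> = (\<Sum>i\<le>k + n. if i \<le> k then coeff Q i * F $ (k - i) else 0)"
      by (intro sum.mono_neutral_cong_left) auto
    also have "\<dots> = (\<Sum>i\<le>n. a r i * x i)"
      by (intro sum.mono_neutral_cong_right) (auto simp: Q a_def r)
    also have "\<dots> = 0" using x(2) that r by simp
    finally show ?thesis using False by (simp add: P)
  qed
  moreover have "Q \<noteq> 0" using x(1) Q by (metis atMost_iff coeff_0)
  moreover have "degree P \<le> m" "degree Q \<le> n" by (auto intro!: degree_le simp: P Q)
  ultimately show ?thesis unfolding pade_pair_def by blast
qed

text \<open>A combination of the two remainders eliminates \<open>F\<close>, leaving a polynomial of
  degree at most \<open>m + n\<close> that vanishes to order \<open>m + n + 1\<close>.\<close>

lemma pade_pair_unique: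
  assumes "pade_pair F m n P Q" "pade_pair F m n P' Q'"
  shows "P * Q' = P' * Q"
proof -
  let ?p = fps_of_poly
  have "(?p Q * (F * ?p Q' - ?p P') - ?p Q' * (F * ?p Q - ?p P)) $ k = 0" if "k < m + n + 1" for k
    using fps_mult_nth_eq_0[of "m + n + 1" "F * ?p Q' - ?p P'" "?p Q"]
      fps_mult_nth_eq_0[of "m + n + 1" "F * ?p Q - ?p P" "?p Q'"] assms that
    by (simp add: pade_pair_def)
  moreover have "?p Q * (F * ?p Q' - ?p P') - ?p Q' * (F * ?p Q - ?p P) = ?p (P * Q' - P' * Q)"
    by (simp add: fps_of_poly_mult fps_of_poly_diff algebra_simps)
  ultimately have "coeff (P * Q' - P' * Q) k = 0" if "k < m + n + 1" for k
    using that by simp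
  moreover have "degree (P * Q' - P' * Q) \<le> m + n"
    using assms degree_mult_le[of P Q'] degree_mult_le[of P' Q]
    unfolding pade_pair_def by (intro degree_diff_le) linarith+
  ultimately have "coeff (P * Q' - P' * Q) k = 0" for k
    using coeff_eq_0[of "P * Q' - P' * Q" k] by (cases "k < m + n + 1") (auto simp del: coeff_diff)
  then have "P * Q' - P' * Q = 0" by (simp add: poly_eq_iff)
  then show ?thesis by simp
qed

text \<open>A degree drop violates regularity at \<open>(m, n + 1)\<close> or
  \<open>(m + 1, n)\<close>. If \<open>Q\<close> vanishes at 0, so does \<open>P\<close>, and
  cancelling \<open>x\<close> from both violates it at \<open>(m, n)\<close>.\<close>

lemma pade_regularD:
  assumes "pade_regular F" "pade_pair F m n P Q"
  shows "degree P = m" "degree Q = n" "P \<noteq> 0" "coeff Q 0 \<noteq> 0"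
proof -
  note reg = assms(1)[unfolded pade_regular_def, rule_format]
  have pp: "Q \<noteq> 0" "degree P \<le> m" "degree Q \<le> n"
    "\<And>k. k < m + n + 1 \<Longrightarrow> (F * fps_of_poly Q - fps_of_poly P) $ k = 0"
    using assms(2) by (auto simp: pade_pair_def)
  have *: "\<not> (\<forall>k\<ge>m. coeff P k = 0)"
  proof
    assume "\<forall>k\<ge>m. coeff P k = 0"
    then have "Q = 0" using pp by (intro reg[of m P "n + 1" Q]) (auto simp: coeff_eq_0)
    then show False using pp by simp
  qed
  then show "P \<noteq> 0" by auto
  show "degree P = m" using * pp(2) coeff_eq_0[of P] by (metis le_neq_implies_less order_less_le_trans)
  have "\<not> (\<forall>k\<ge>n. coeff Q k = 0)"
  proof
    assume "\<forall>k\<ge>n. coeff Q k = 0"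
    then have "Q = 0" using pp by (intro reg[of "m + 1" P n Q]) (auto simp: coeff_eq_0)
    then show False using pp by simp
  qed
  then show "degree Q = n" using pp(3) coeff_eq_0[of Q] by (metis le_neq_implies_less order_less_le_trans)
  show "coeff Q 0 \<noteq> 0"
  proof
    assume Q0: "coeff Q 0 = 0"
    then have P0: "coeff P 0 = 0" using pp(4)[of 0] by simp
    obtain Q1 where Q1: "Q = pCons 0 Q1" using Q0 by (metis coeff_pCons_0 pCons_cases)
    obtain P1 where P1: "P = pCons 0 P1" using P0 by (metis coeff_pCons_0 pCons_cases)
    have "F * fps_of_poly Q - fps_of_poly P = fps_X * (F * fps_of_poly Q1 - fps_of_poly P1)"
      by (simp add: Q1 P1 fps_of_poly_pCons algebra_simps)
    then have "(F * fps_of_poly Q1 - fps_of_poly P1) $ k = 0" if "k < m + n" for k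
      using pp(4)[of "Suc k"] that by (simp add: fps_X_mult_nth)
    moreover have "coeff P1 k = 0" if "k \<ge> m" for k
      using pp(2) that coeff_eq_0[of P "Suc k"] by (simp add: P1)
    moreover have "coeff Q1 k = 0" if "k \<ge> n" for k
      using pp(3) that coeff_eq_0[of Q "Suc k"] by (simp add: Q1)
    ultimately have "Q1 = 0" by (intro reg[of m P1 n Q1]) auto
    then show False using pp(1) Q1 by simp
  qed
qed

text \<open>If \<open>m < m'\<close>, then also \<open>n < n'\<close>. As \<open>Q'\<close> is
  invertible as a series, the remainder of \<open>P\<close>, \<open>Q\<close> inherits the higher
  order, against regularity at \<open>(m + 1, n + 1)\<close>.\<close>

lemma pade_pair_eq_imp_le:
  assumes F: "pade_regular F" and p: "pade_pair F m n P Q" and p': "pade_pair F m' n' P' Q'"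
    and eq: "P * Q' = P' * Q"
  shows "m' \<le> m" "m + n' = m' + n"
proof -
  note d = pade_regularD[OF F p] and d' = pade_regularD[OF F p']
  have Q: "Q \<noteq> 0" "Q' \<noteq> 0" using p p' by (auto simp: pade_pair_def)
  show mn: "m + n' = m' + n"
    using arg_cong[OF eq, of degree] d d' Q by (simp add: degree_mult_eq)
  show "m' \<le> m"
  proof (rule ccontr)
    assume "\<not> m' \<le> m"
    let ?p = fps_of_poly
    have "?p Q' * (F * ?p Q - ?p P) = F * ?p Q * ?p Q' - ?p (P * Q')"
      by (simp add: fps_of_poly_mult algebra_simps)
    also have "\<dots> = ?p Q * (F * ?p Q' - ?p P')"
      by (simp add: eq fps_of_poly_mult algebra_simps)
    finally have *: "?p Q' * (F * ?p Q - ?p P) = ?p Q * (F * ?p Q' - ?p P')" .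
    have "F * ?p Q - ?p P = inverse (?p Q') * (?p Q' * (F * ?p Q - ?p P))"
      using inverse_mult_eq_1[of "?p Q'"] d'(4) by (simp flip: mult.assoc)
    also have "\<dots> = (inverse (?p Q') * ?p Q) * (F * ?p Q' - ?p P')"
      by (simp only: * mult.assoc)
    finally have "\<forall>k<m' + n' + 1. (F * ?p Q - ?p P) $ k = 0"
      using p' fps_mult_nth_eq_0 unfolding pade_pair_def by metis
    then have "Q = 0"
      using F[unfolded pade_regular_def, rule_format, of "m + 1" P "n + 1" Q] d \<open>\<not> m' \<le> m\<close> mn
      by (auto simp: coeff_eq_0)
    then show False using Q by simp
  qed
qed

section \<open>From the order condition to power series coefficients\<close>

lemma bigo_iff_fps_nth:
  assumes g: "g has_fps_expansion (G :: complex fps)"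
  shows "g \<in> O[at 0](\<lambda>z. z ^ K) \<longleftrightarrow> (\<forall>k<K. G $ k = 0)"
proof (cases "G = 0")
  case True
  then have "eventually (\<lambda>z. g z = 0) (at 0)"
    using g by (simp add: has_fps_expansion_0_iff eventually_at_filter eventually_mono)
  then have "g \<in> O[at 0](\<lambda>z. z ^ K) \<longleftrightarrow> (\<lambda>_. 0) \<in> O[at 0](\<lambda>z::complex. z ^ K)"
    by (rule landau_o.big.in_cong)
  then show ?thesis using True by simp
next
  case False
  define s where "s = subdegree G"
  have Gs: "G $ s \<noteq> 0" using False by (simp add: s_def)
  \<comment> \<open>Near 0 a nonzero series behaves like its lowest term, so only two powers of
    \<open>z\<close> have to be compared.\<close>
  have "g \<sim>[at 0] (\<lambda>z. G $ s * z ^ s)"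
    using has_fps_expansion_imp_asymp_equiv_0[OF g] unfolding s_def asymp_equiv_def
    by (rule tendsto_mono[rotated]) (simp add: at_within_def)
  then have "g \<in> \<Theta>[at 0](\<lambda>z. G $ s * z ^ s)" by (rule asymp_equiv_imp_bigtheta)
  also have "(\<lambda>z. G $ s * z ^ s) \<in> \<Theta>[at 0](\<lambda>z. z ^ s)" using Gs by simp
  finally have "g \<in> \<Theta>[at 0](\<lambda>z. z ^ s)" .
  then have "g \<in> O[at 0](\<lambda>z. z ^ K) \<longleftrightarrow> (\<lambda>z. z ^ s) \<in> O[at 0](\<lambda>z::complex. z ^ K)"
    by (rule landau_o.big.in_cong_bigtheta)
  also have "\<dots> \<longleftrightarrow> K \<le> s"
  proof
    assume le: "(\<lambda>z. z ^ s) \<in> O[at 0](\<lambda>z::complex. z ^ K)"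
    show "K \<le> s"
    proof (rule ccontr)
      assume "\<not> K \<le> s"
      then have "((\<lambda>z::complex. z ^ (K - s)) \<longlongrightarrow> 0) (at 0)"
        by (auto intro!: tendsto_eq_intros)
      then have "(\<lambda>z::complex. z ^ (K - s)) \<in> o[at 0](\<lambda>_. 1)"
        by (intro smalloI_tendsto) auto
      from landau_o.small_big_mult[OF this landau_o.big_refl, of "\<lambda>z. z ^ s"]
      have "(\<lambda>z::complex. z ^ K) \<in> o[at 0](\<lambda>z. z ^ s)"
        using \<open>\<not> K \<le> s\<close> by (simp flip: power_add)
      with le have "(\<lambda>z::complex. z ^ s) \<in> o[at 0](\<lambda>z. z ^ s)"
        by (rule landau_o.big_small_trans)
      then have "\<forall>\<^sub>F z::complex in at 0. z ^ s = 0"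
        by (simp add: landau_o.small_refl_iff)
      then have "\<forall>\<^sub>F z::complex in at 0. False"
        using eventually_neq_at_within[of "0::complex" 0 UNIV] by eventually_elim simp
      then show False by simp
    qed
  next
    assume "K \<le> s"
    then have "(\<lambda>z::complex. z ^ s) = (\<lambda>z. z ^ (s - K) * z ^ K)" by (simp flip: power_add)
    moreover have "(\<lambda>z::complex. z ^ (s - K)) \<in> O[at 0](\<lambda>_. 1)"
      by (intro bigoI_tendsto) (auto intro!: tendsto_eq_intros)
    ultimately show "(\<lambda>z. z ^ s) \<in> O[at 0](\<lambda>z::complex. z ^ K)"
      using landau_o.big.mult_right[of "\<lambda>z::complex. z ^ (s - K)" "at 0" "\<lambda>_. 1" "\<lambda>z. z ^ K"] by simp
  qed
  also have "K \<le> s \<longleftrightarrow> (\<forall>k<K. G $ k = 0)"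
    using Gs nth_less_subdegree_zero[of _ G] unfolding s_def by (metis not_le order_less_le_trans)
  finally show ?thesis .
qed

lemma is_pade_iff:
  assumes "f has_fps_expansion F"
  shows "is_pade f m n R \<longleftrightarrow> (\<exists>P Q. pade_pair F m n P Q \<and> R = Fract P Q)"
proof -
  have poly: "poly p has_fps_expansion fps_of_poly p" for p :: "complex poly"
    by (simp add: has_fps_expansion_def)
  have "(\<lambda>z. f z * poly Q z - poly P z) \<in> O[at 0](\<lambda>z. z ^ (m + n + 1)) \<longleftrightarrow>
      (\<forall>k<m + n + 1. (F * fps_of_poly Q - fps_of_poly P) $ k = 0)" for P Q
    by (intro bigo_iff_fps_nth has_fps_expansion_diff has_fps_expansion_mult assms poly)
  then show ?thesis unfolding is_pade_def pade_pair_def by blast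
qed

lemma pade_normal_if_regular:
  assumes f: "f has_fps_expansion F" and F: "pade_regular F"
  shows "pade_normal f (pade f m n)"
proof -
  have pair: "\<exists>P Q. pade_pair F m n P Q \<and> pade f m n = Fract P Q" for m n
  proof -
    obtain P Q where p: "pade_pair F m n P Q" using pade_pair_exists by blast
    have "pade f m n = Fract P Q"
      unfolding pade_def
    proof (rule the_equality)
      show "is_pade f m n (Fract P Q)" unfolding is_pade_iff[OF f] using p by blast
      fix R assume "is_pade f m n R"
      then obtain P' Q' where p': "pade_pair F m n P' Q'" "R = Fract P' Q'"
        unfolding is_pade_iff[OF f] by blast
      then show "R = Fract P Q"
        using pade_pair_unique[OF p'(1) p] p by (simp add: pade_pair_def eq_fract)
    qed
    then show ?thesis using p by blast
  qed
  have inj: "m = m' \<and> n = n'" if "pade f m n = pade f m' n'" for m n m' n'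
  proof -
    obtain P Q where p: "pade_pair F m n P Q" "pade f m n = Fract P Q"
      using pair by blast
    obtain P' Q' where p': "pade_pair F m' n' P' Q'" "pade f m' n' = Fract P' Q'"
      using pair by blast
    have eq: "P * Q' = P' * Q"
      using that p p' by (simp add: pade_pair_def eq_fract)
    show ?thesis
      using pade_pair_eq_imp_le[OF F p(1) p'(1) eq] pade_pair_eq_imp_le[OF F p'(1) p(1) eq[symmetric]]
      by simp
  qed
  show ?thesis
    unfolding pade_normal_def
  proof (rule ex1I[of _ "(m, n)"])
    fix p assume "pade f (fst p) (snd p) = pade f m n"
    then show "p = (m, n)" using inj by (metis prod.collapse)
  qed simp
qed

subsection \<open>The hypergeometric series\<close>

lemma foldl_mult_of_real:
  "foldl (\<lambda>r a. r * (a + of_nat n)) (of_real v) (map of_real xs) =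
     (of_real (v * (\<Prod>a\<leftarrow>xs. a + real n)) :: complex)"
proof (induction xs arbitrary: v)
  case (Cons x xs)
  have "of_real v * (of_real x + of_nat n) = (of_real (v * (x + real n)) :: complex)" by simp
  then show ?case by (simp only: list.map foldl.simps Cons.IH prod_list.Cons mult.assoc)
qed simp

text \<open>The factorial \<open>n!\<close> is the Pochhammer symbol of 1, so it enters as an
  additional lower parameter 1, paired with \<open>\<sigma>\<close>.\<close>

lemma hypergeo_nth_eq_ratio_seq:
  "fps_hypergeo (map complex_of_real (\<sigma> # A)) (map complex_of_real B) 1 $ n =
     of_real (ratio_seq (list_ratio (\<sigma> # A) (1 # B)) 0 n)"
proof (induction n)
  case 0
  show ?case by (simp only: fps_hypergeo_0) (simp add: ratio_seq_def)
next
  case (Suc n)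
  have "fps_hypergeo (map complex_of_real (\<sigma> # A)) (map complex_of_real B) 1 $ Suc n =
    of_real (\<Prod>a\<leftarrow>\<sigma> # A. a + real n) / of_real (real (Suc n) * (\<Prod>b\<leftarrow>B. b + real n)) *
    of_real (ratio_seq (list_ratio (\<sigma> # A) (1 # B)) 0 n)"
    unfolding fps_hypergeo_rec Suc.IH
    using foldl_mult_of_real[of n 1 "\<sigma> # A"] foldl_mult_of_real[of n "real (Suc n)" B] by simp
  moreover have "ratio_seq (list_ratio (\<sigma> # A) (1 # B)) 0 (Suc n) =
      (\<Prod>a\<leftarrow>\<sigma> # A. a + real n) / (real (Suc n) * (\<Prod>b\<leftarrow>B. b + real n)) *
      ratio_seq (list_ratio (\<sigma> # A) (1 # B)) 0 n"
    by (simp add: ratio_seq_def list_ratio_def)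
  ultimately show ?case by (simp only: of_real_mult of_real_divide)
qed

lemma hypergeom_F_uminus_has_fps_expansion:
  assumes "(\<lambda>n. norm (F $ n) / norm (F $ (Suc n))) \<longlonglongrightarrow> 1"
    and F: "\<And>n. F $ n = (-1) ^ n * fps_hypergeo (map complex_of_real (\<sigma> # A)) (map complex_of_real B) 1 $ n"
  shows "(\<lambda>z. hypergeom_F \<sigma> A B (- z)) has_fps_expansion F"
  unfolding has_fps_expansion_def
proof
  have "fps_conv_radius F = 1"
    unfolding fps_conv_radius_def
    using assms(1) by (intro conv_radius_ratio_limit_nonzero[of _ 1]) auto
  then show "0 < fps_conv_radius F" by simp
  have "eval_fps F z = hypergeom_F \<sigma> A B (- z)" if "norm z < 1" for z
    using that unfolding hypergeom_F_def hypergeom_series_def eval_fps_def F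
    by (simp add: power_minus[of z] mult_ac del: fps_hypergeo_nth)
  then show "\<forall>\<^sub>F z in nhds 0. eval_fps F z = hypergeom_F \<sigma> A B (- z)"
    by (intro eventually_mono[OF eventually_nhds_in_open[of "ball 0 1" 0]]) auto
qed

theorem theorem9:
  fixes A B :: "real list" and \<sigma> :: real and q :: nat
  assumes "q \<ge> 1" and "length A = q" and "length B = q"
    and "B \<prec>\<^sup>W A"
    and "0 < \<sigma>" and "\<sigma> \<le> 1"
    and "\<not> (\<sigma> = 1 \<and> A = B)"
  shows "\<forall>m n :: nat.
    pade_normal (\<lambda>z. hypergeom_F \<sigma> A B (- z)) (pade (\<lambda>z. hypergeom_F \<sigma> A B (- z)) m n)"
proof -
  have A: "\<forall>a\<in>set A. 0 < a" and B: "\<forall>b\<in>set B. 0 < b" and len: "length A = length B"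
    using assms(4) by (auto simp: weak_supermaj_def)
  have "sum_list (take k A) \<le> sum_list (take k B)" if "k \<le> length A" for k
    using assms(4) that by (cases "k = 0") (auto simp: weak_supermaj_def)
  then have AB: "A = B \<or> pd_multiplier (list_ratio A B)"
    using assms(4) by (intro pd_multiplier_list_ratio) (auto simp: weak_supermaj_def)
  define \<phi> where "\<phi> = list_ratio (\<sigma> # A) (1 # B)"
  have \<phi>: "pd_multiplier \<phi>"
  \<comment> \<open>For \<open>\<sigma> < 1\<close> the pair \<open>\<sigma>\<close>, 1 supplies a
    strict factor; for \<open>\<sigma> = 1\<close> it cancels, and strictness comes from
    \<open>A\<close> and \<open>B\<close> being different.\<close>
  proof (cases "\<sigma> = 1")
    case True
    have "pd_multiplier \<phi> \<longleftrightarrow> pd_multiplier (list_ratio A B)"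
      by (intro pd_multiplier_cong) (simp add: \<phi>_def True)
    then show ?thesis using AB assms(7) True by simp
  next
    case False
    have "pd_multiplier (\<lambda>x. (1 + x) / (\<sigma> + x) * list_ratio A B x)"
      using False assms(5,6) A AB by (intro pd_multiplier_mult pd_multiplier_ratio psd_list_ratio) auto
    then show ?thesis by (simp add: \<phi>_def fun_eq_iff cong: pd_multiplier_cong)
  qed
  have \<phi>_lim: "(\<phi> \<longlongrightarrow> 1) at_top"
    unfolding \<phi>_def by (rule tendsto_list_ratio) (simp add: len)
  have \<phi>_pos: "0 < \<phi> x" if "0 \<le> x" for x using \<phi> that by (simp add: pd_multiplier_def)
  note \<phi>_psd = pd_multiplier_imp_psd[OF \<phi>]
  define f where "f = Abs_fps (ratio_seq \<phi> 0)"
  have f0: "f $ 0 \<noteq> 0" by (simp add: f_def ratio_seq_def)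
  have c0: "hankel_pd (\<lambda>n. f $ n)"
    using hankel_pd_ratio_seq[OF \<phi> \<phi>_lim, of 0] by (simp add: f_def)
  have c1: "hankel_pd (\<lambda>n. f $ (n + 1))"
    using hankel_pd_cmult[OF _ hankel_pd_ratio_seq[OF \<phi> \<phi>_lim, of 1], of "1 / \<phi> 0"] \<phi>_pos[of 0]
      ratio_seq_Suc_arg[OF \<phi>_psd, of 0] by (simp add: f_def)
  \<comment> \<open>The argument \<open>-z\<close> alternates the signs of the coefficients;
    \<open>G\<close> is the reciprocal of \<open>f\<close> with the same substitution.\<close>
  define F where "F = Abs_fps (\<lambda>n. (-1) ^ n * complex_of_real (f $ n))"
  define G where "G = Abs_fps (\<lambda>n. (-1) ^ n * complex_of_real (inverse f $ n))"
  have "F * G = 1"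
  proof (rule fps_ext)
    fix n
    have "(F * G) $ n = (\<Sum>i=0..n. (-1) ^ n * complex_of_real (f $ i * inverse f $ (n - i)))"
      unfolding fps_mult_nth
      by (intro sum.cong) (auto simp: F_def G_def mult_ac simp flip: power_add)
    also have "\<dots> = (-1) ^ n * complex_of_real ((f * inverse f) $ n)"
      by (simp only: fps_mult_nth of_real_sum sum_distrib_left)
    also have "\<dots> = 1 $ n"
      unfolding inverse_mult_eq_1'[OF f0] by simp
    finally show "(F * G) $ n = 1 $ n" .
  qed
  then have G: "inverse F = G" by (rule fps_inverse_unique)
  have "hankel_regular (\<lambda>n. (-1) * (-1) ^ n * of_real (f $ (n + 1)))"
    using hankel_pd_shift_even[OF c0, of 1] c1 by (intro hankel_regularI) (auto simp: add_ac)
  then have "hankel_regular (\<lambda>k. F $ (k + 1))" by (simp add: F_def)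
  \<comment> \<open>The sign from shifting the index by one cancels the minus sign in front of the
    coefficients of \<open>inverse f\<close>.\<close>
  moreover have "hankel_regular (\<lambda>n. 1 * (-1) ^ n * of_real (- (inverse f $ (n + 1))))"
    using hankel_pd_inverse_1[OF f0] hankel_pd_inverse_2[OF f0 c0] c1
    by (intro hankel_regularI) (auto simp: add_ac)
  then have "hankel_regular (\<lambda>k. inverse F $ (k + 1))" by (simp add: G G_def)
  moreover have "F $ 0 \<noteq> 0" using f0 by (simp add: F_def)
  ultimately have "pade_regular F" by (rule pade_regularI)
  moreover have "(\<lambda>z. hypergeom_F \<sigma> A B (- z)) has_fps_expansion F"
  proof (rule hypergeom_F_uminus_has_fps_expansion)
    have "norm (F $ n) / norm (F $ Suc n) = \<phi> (real n)" for n
    proof -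
      have "ratio_seq \<phi> 0 (Suc n) = ratio_seq \<phi> 0 n / \<phi> (real n)"
        by (simp add: ratio_seq_def)
      then show ?thesis
        using ratio_seq_pos[OF \<phi>_psd, of 0 n] \<phi>_pos[of "real n"]
        by (simp add: F_def f_def norm_mult norm_power norm_divide)
    qed
    then show "(\<lambda>n. norm (F $ n) / norm (F $ Suc n)) \<longlonglongrightarrow> 1"
      using filterlim_compose[OF \<phi>_lim filterlim_real_sequentially] by simp
    show "F $ n = (-1) ^ n * fps_hypergeo (map complex_of_real (\<sigma> # A)) (map complex_of_real B) 1 $ n" for n
      unfolding hypergeo_nth_eq_ratio_seq by (simp add: F_def f_def \<phi>_def)
  qed
  ultimately show ?thesis using pade_normal_if_regular by blast
qed

end
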